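(* For every pair $a,b$ of nonzero rational numbers, the set of rational points on the surface $\mathcal{S}: x^2+ay^5-z^6=b$ is infinite. *)

theory Defs
  imports Complex_Main
begin

definition surface_points :: "rat \<Rightarrow> rat \<Rightarrow> (rat \<times> rat \<times> rat) set" where
  "surface_points a b = {(x, y, z). x ^ 2 + a * y ^ 5 - z ^ 6 = b}"

end

(* Substituting x = z^3 + p z^2 + q z + r and y = s z + t makes the equation a quintic in z.
   For fixed s and t, suitable p, q and r cancel its z^5, z^4 and z^3 terms. For t = a s^6 w
   the z^2 coefficient is then a^4 s^20 times a cubic in w with rational coefficients, which
   has the rational root w = -1/8. The equation that remains is linear in z, so each nonzero
   s (written s = 2 u below) gives a rational point. *)
theory Submission
  imports Defs "HOL-Computational_Algebra.Polynomial"
begin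

text \<open>The case s = 2 \<open>u\<close>, w = -1/8; the factor 2 clears the denominators of p, q
  and r.\<close>

lemma surface_linear_in_z:
  fixes a u z :: rat
  shows "(z ^ 3 - 16 * a * u ^ 5 * z ^ 2 + 192 * a ^ 2 * u ^ 10 * z + 512 * a ^ 3 * u ^ 15) ^ 2
      + a * (2 * u * z - 8 * a * u ^ 6) ^ 5 - z ^ 6
    = 237568 * a ^ 5 * u ^ 25 * z + 229376 * a ^ 6 * u ^ 30"
  by algebra

text \<open>The root \<open>z\<close> when the linear form in \<open>surface_linear_in_z\<close> is
  set equal to \<open>b\<close>.\<close>

definition curve_z :: "rat \<Rightarrow> rat \<Rightarrow> rat \<Rightarrow> rat" where
  "curve_z a b u = (b - 229376 * a ^ 6 * u ^ 30) / (237568 * a ^ 5 * u ^ 25)"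

lemma curve_z_eq:
  assumes "a \<noteq> 0" and "u \<noteq> 0"
  shows "237568 * a ^ 5 * u ^ 25 * curve_z a b u + 229376 * a ^ 6 * u ^ 30 = b"
  using assms by (simp add: curve_z_def)

lemma curve_z_in_surface:
  assumes "a \<noteq> 0" and "u \<noteq> 0"
  shows "curve_z a b u \<in> (\<lambda>(x, y, z). z) ` surface_points a b"
proof -
  define z where "z = curve_z a b u"
  have "(z ^ 3 - 16 * a * u ^ 5 * z ^ 2 + 192 * a ^ 2 * u ^ 10 * z + 512 * a ^ 3 * u ^ 15,
      2 * u * z - 8 * a * u ^ 6, z) \<in> surface_points a b"
    using surface_linear_in_z[of z a u] curve_z_eq[OF assms, of b]
    by (simp add: surface_points_def z_def)
  then show ?thesis
    by (force simp: z_def)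
qed

text \<open>For fixed z = \<open>c\<close> the linear equation is a polynomial equation in
  \<open>u\<close> with constant term \<open>- b\<close>, which is nonzero, so it has finitely many
  roots.\<close>

lemma finite_curve_z_fibre:
  assumes "a \<noteq> 0" and "b \<noteq> 0"
  shows "finite {u. u \<noteq> 0 \<and> curve_z a b u = c}"
proof -
  define P where
    "P = monom (229376 * a ^ 6) 30 + monom (237568 * a ^ 5 * c) 25 - [:b:]"
  have "poly P 0 \<noteq> 0"
    using assms by (simp add: P_def poly_monom)
  then have "P \<noteq> 0"
    by auto
  moreover have "poly P u = 0" if "u \<noteq> 0" "curve_z a b u = c" for u
    using curve_z_eq[OF assms(1) that(1), of b] that(2)
    by (simp add: P_def poly_monom algebra_simps)
  ultimately show ?thesis
    by (auto intro: finite_subset[OF _ poly_roots_finite])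
qed

theorem theorem2:
  fixes a b :: rat
  assumes "a \<noteq> 0" and "b \<noteq> 0"
  shows "infinite (surface_points a b)"
proof
  assume "finite (surface_points a b)"
  \<comment> \<open>Projecting to z suffices: finitely many values over infinitely many
    \<open>u\<close> force an infinite fibre.\<close>
  then have "finite (curve_z a b ` (- {0}))"
    by (rule finite_subset[rotated, OF finite_imageI[where h = "\<lambda>(x, y, z). z"]])
      (auto intro!: curve_z_in_surface assms)
  moreover have "infinite (- {0 :: rat})"
    by (simp add: infinite_UNIV_char_0 Compl_eq_Diff_UNIV)
  ultimately obtain u\<^sub>0 where "infinite {u \<in> - {0}. curve_z a b u = curve_z a b u\<^sub>0}"
    using pigeonhole_infinite by blast
  then show False
    using finite_curve_z_fibre[OF assms, of "curve_z a b u\<^sub>0"] by simp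
qed

end
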